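(* Let $\mathcal{F}$ be a class of functions $\mathbb{N}\to\mathbb{R}_{\ge0}$ that contains arbitrarily large constant functions. Then there is no algorithm that, given a one-tape Turing machine $M$, decides whether $M$ runs in time $T(n)$ for some $T\in\mathcal{F}$.
   Context: $\mathbb{N}=\{0,1,2,\dots\}$. "Contains arbitrarily large constants" means: for every $r\in\mathbb{R}$ there is a constant function in $\mathcal{F}$ with value at least $r$. Turing machines are deterministic. A one-tape Turing machine has a single both-way infinite read-write tape which also holds the input, and its head moves (left or right) at every step. A Turing machine $M$ runs in time $T(n)$ if for every $n$, $M$ makes at most $T(n)$ steps on every input of length $n$. *)

theory Defs
  imports Complex_Main
begin

text \<open>
  One-tape deterministic Turing machines. A machine is a finite object, so that it can be handed to
  an algorithm: up to renaming, the states are \<open>{..<states M}\<close>, the tape alphabet is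
  \<open>{..<symbols M}\<close> with blank \<open>0\<close>, and the input alphabet is \<open>{1..inputs M}\<close>.
  The head has no option of staying in place. Only the values of \<open>trans M q a\<close> at non-halting
  states \<open>q < states M\<close> and symbols \<open>a < symbols M\<close> belong to the machine; all
  other values of the HOL function \<open>trans M\<close> are irrelevant to every notion below.
\<close>

datatype direction = Left | Right

record tm =
  states :: nat
  symbols :: nat
  inputs :: nat
  start_state :: nat
  accept_state :: nat
  reject_state :: nat
  trans :: "nat \<Rightarrow> nat \<Rightarrow> nat \<times> nat \<times> direction"

definition halting_state :: "tm \<Rightarrow> nat \<Rightarrow> bool" where
  "halting_state M q \<longleftrightarrow> q = accept_state M \<or> q = reject_state M"

definition turing_machine :: "tm \<Rightarrow> bool" where
  "turing_machine M \<longleftrightarrow>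
     1 \<le> inputs M \<and> inputs M < symbols M \<and>
     start_state M < states M \<and> accept_state M < states M \<and> reject_state M < states M \<and>
     accept_state M \<noteq> reject_state M \<and>
     (\<forall>q < states M. \<forall>a < symbols M. \<not> halting_state M q \<longrightarrow>
        (case trans M q a of (q', a', d) \<Rightarrow> q' < states M \<and> a' < symbols M))"

record configuration =
  state :: nat
  head :: int
  tape :: "int \<Rightarrow> nat"

definition initial :: "tm \<Rightarrow> nat list \<Rightarrow> configuration" where
  "initial M w = \<lparr>state = start_state M, head = 0,
     tape = (\<lambda>i. if 0 \<le> i \<and> i < int (length w) then w ! nat i else 0)\<rparr>"

definition step :: "tm \<Rightarrow> configuration \<Rightarrow> configuration" where
  "step M c =
     (if halting_state M (state c) then c
      else case trans M (state c) (tape c (head c)) of (q, a, d) \<Rightarrow>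
        \<lparr>state = q,
         head = (case d of Left \<Rightarrow> head c - 1 | Right \<Rightarrow> head c + 1),
         tape = (tape c)(head c := a)\<rparr>)"

definition run :: "tm \<Rightarrow> nat list \<Rightarrow> nat \<Rightarrow> configuration" where
  "run M w t = (step M ^^ t) (initial M w)"

definition input_word :: "tm \<Rightarrow> nat list \<Rightarrow> bool" where
  "input_word M w \<longleftrightarrow> set w \<subseteq> {1..inputs M}"

definition halts_after :: "tm \<Rightarrow> nat list \<Rightarrow> nat \<Rightarrow> bool" where
  "halts_after M w t \<longleftrightarrow>
     halting_state M (state (run M w t)) \<and> (\<forall>s < t. \<not> halting_state M (state (run M w s)))"

text \<open>A computation that does not halt makes infinitely many steps and so exceeds every bound.\<close>

definition runs_in_time :: "tm \<Rightarrow> (nat \<Rightarrow> real) \<Rightarrow> bool" where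
  "runs_in_time M T \<longleftrightarrow>
     (\<forall>n. \<forall>w. input_word M w \<and> length w = n \<longrightarrow> (\<exists>t. halts_after M w t \<and> real t \<le> T n))"

definition accepts :: "tm \<Rightarrow> nat list \<Rightarrow> bool" where
  "accepts M w \<longleftrightarrow> (\<exists>t. state (run M w t) = accept_state M)"

definition rejects :: "tm \<Rightarrow> nat list \<Rightarrow> bool" where
  "rejects M w \<longleftrightarrow> (\<exists>t. state (run M w t) = reject_state M)"

text \<open>
  A machine is presented to an algorithm as a word over the two letters \<open>1\<close> and \<open>2\<close>:
  all numbers in unary, first the six parameters, then the transition table, listed for the
  non-halting states and all tape symbols in increasing order.
\<close>

definition unary :: "nat \<Rightarrow> nat list" where
  "unary n = replicate n 1 @ [2]"

definition encode_entry :: "nat \<times> nat \<times> direction \<Rightarrow> nat list" where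
  "encode_entry e = (case e of (q, a, d) \<Rightarrow>
     unary q @ unary a @ [case d of Left \<Rightarrow> 1 | Right \<Rightarrow> 2])"

definition table_positions :: "tm \<Rightarrow> (nat \<times> nat) list" where
  "table_positions M =
     [(q, a). q \<leftarrow> [0..<states M], \<not> halting_state M q, a \<leftarrow> [0..<symbols M]]"

definition encode :: "tm \<Rightarrow> nat list" where
  "encode M =
     unary (states M) @ unary (symbols M) @ unary (inputs M) @
     unary (start_state M) @ unary (accept_state M) @ unary (reject_state M) @
     concat (map (\<lambda>(q, a). encode_entry (trans M q a)) (table_positions M))"

text \<open>
  Decidability of a property of one-tape Turing machines, with algorithms being Turing machines.
  The behaviour of the deciding machine on words that encode no machine is unconstrained.
\<close>

definition decides :: "tm \<Rightarrow> (tm \<Rightarrow> bool) \<Rightarrow> bool" where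
  "decides D P \<longleftrightarrow>
     (\<forall>M. turing_machine M \<longrightarrow>
        (P M \<longrightarrow> accepts D (encode M)) \<and> (\<not> P M \<longrightarrow> rejects D (encode M)))"

definition algorithmically_decidable :: "(tm \<Rightarrow> bool) \<Rightarrow> bool" where
  "algorithmically_decidable P \<longleftrightarrow> (\<exists>D. turing_machine D \<and> 2 \<le> inputs D \<and> decides D P)"

definition arbitrarily_large_constants :: "(nat \<Rightarrow> real) set \<Rightarrow> bool" where
  "arbitrarily_large_constants F \<longleftrightarrow> (\<forall>r. \<exists>c \<ge> r. (\<lambda>n. c) \<in> F)"

text \<open>The encoding determines the machine.\<close>

lemma unary_append_eq: "unary m @ xs = unary n @ ys \<longleftrightarrow> m = n \<and> xs = ys"
proof (induction m arbitrary: n)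
  case 0
  show ?case by (cases n) (auto simp: unary_def)
next
  case (Suc m)
  then show ?case by (cases n) (auto simp: unary_def)
qed

lemma encode_entry_append_eq:
  "encode_entry e @ xs = encode_entry f @ ys \<longleftrightarrow> e = f \<and> xs = ys"
  by (auto simp: encode_entry_def unary_append_eq split: prod.splits direction.splits)

lemma concat_encode_entry_eq:
  "concat (map (\<lambda>z. encode_entry (f z)) zs) = concat (map (\<lambda>z. encode_entry (g z)) zs)
     \<longleftrightarrow> (\<forall>z \<in> set zs. f z = g z)"
  by (induction zs) (auto simp: encode_entry_append_eq)

lemma encode_eq_iff:
  "encode M = encode N \<longleftrightarrow>
     states M = states N \<and> symbols M = symbols N \<and> inputs M = inputs N \<and>
     start_state M = start_state N \<and> accept_state M = accept_state N \<and>
     reject_state M = reject_state N \<and>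
     (\<forall>q < states M. \<forall>a < symbols M. \<not> halting_state M q \<longrightarrow> trans M q a = trans N q a)"
  (is "_ \<longleftrightarrow> ?R")
proof -
  have set_pos: "set (table_positions M) =
      {(q, a). q < states M \<and> a < symbols M \<and> \<not> halting_state M q}"
    by (auto simp: table_positions_def)
  have pos: "table_positions M = table_positions N"
    if "states M = states N" "symbols M = symbols N"
      "accept_state M = accept_state N" "reject_state M = reject_state N"
    using that by (simp add: table_positions_def halting_state_def cong: if_cong)
  have split: "(\<lambda>(q, a). encode_entry (trans K q a))
      = (\<lambda>z. encode_entry (trans K (fst z) (snd z)))" for K :: tm
    by auto
  have table: "concat (map (\<lambda>(q, a). encode_entry (trans M q a)) (table_positions M)) =
        concat (map (\<lambda>(q, a). encode_entry (trans N q a)) (table_positions M)) \<longleftrightarrow>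
      (\<forall>q < states M. \<forall>a < symbols M. \<not> halting_state M q \<longrightarrow> trans M q a = trans N q a)"
    unfolding split concat_encode_entry_eq set_pos by auto
  show ?thesis
    unfolding encode_def unary_append_eq table[symmetric] using pos by metis
qed

end

theory Submission
  imports Defs
begin

text \<open>
  A machine that diagonalizes against a supposed decider \<open>D\<close> has to produce its own code. On a
  nonempty input it stops after one step. On the empty input it writes a script, one state per
  letter, expands the script into its own code next to it, and simulates \<open>D\<close> on the result,
  looping if \<open>D\<close> accepts and stopping if \<open>D\<close> rejects. If it halts on the empty input, its
  running time is bounded by a constant on all inputs, hence by a member of \<open>F\<close>; otherwise it
  runs in no time bound at all. Either way \<open>D\<close> gives the wrong answer.

  Giving the writing states the numbers \<open>b, \<dots>, b + n - 1\<close> and the state after them the number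
  \<open>b + n\<close>, where \<open>b\<close> counts the other states and \<open>n\<close> is the length of the script, keeps
  the table of those other states independent of the script. The code of the machine is then
  \<open>1^n P H B_0 \<dots> B_(n-1) E\<close> with \<open>B_i = 1^(i+1) P Z\<close>, where \<open>P\<close>, \<open>H\<close> and \<open>E\<close> are
  fixed words and \<open>Z\<close> depends only on the \<open>i\<close>-th letter of the script. So the script need only
  list \<open>P\<close>, \<open>H\<close>, \<open>E\<close> and the three possible words \<open>Z\<close>, and the expansion consists of
  left-to-right sweeps over it.
\<close>

section \<open>Letters, zones and phases of the script expansion\<close>

datatype letter = One | Two | Sep

text \<open>The zones hold the words \<open>P\<close>, \<open>H\<close>, \<open>E\<close> and then
  the word \<open>Z\<close> for a script letter \<open>One\<close>, \<open>Two\<close> and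
  \<open>Sep\<close>. A letter \<open>Sep\<close> in the script marks the passage to the next
  zone.\<close>

datatype zone = ZoneP | ZoneH | ZoneE | Zone1 | Zone2 | ZoneS

text \<open>\<open>Prelude\<close> copies \<open>P H\<close>, \<open>Finale\<close> copies
  \<open>E\<close>, and \<open>Block x rest\<close> copies \<open>P Z\<close> for the script letter
  \<open>x\<close>. The Boolean remembers whether script positions remain, which decides at the end
  of the sweep whether another block follows.\<close>

datatype copying = Prelude | Block letter bool | Finale

datatype phase = Ones | Copy copying zone | Find | Found letter bool

text \<open>
  In \<open>Cell x flag mark\<close> the flag says that the block of this script position has been
  started, and the mark is where the head returns after it has appended a letter to the output.
\<close>

datatype symbol = Sym nat | Cell letter bool bool

text \<open>\<open>Append\<close> carries a letter right to the first blank, \<open>Return\<close>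
  goes back to the mark, \<open>Rewind\<close> goes back to the start of the script. There are two
  halting states because the machine model demands distinct ones.\<close>

datatype control =
    Accept
  | Reject
  | Scan phase
  | Append phase letter
  | Return phase
  | Rewind phase
  | Launch
  | Simulate nat

text \<open>The value at \<open>Sep\<close> is never output.\<close>

fun digit :: "letter \<Rightarrow> nat" where
  "digit One = 1"
| "digit Two = 2"
| "digit Sep = 2"

definition letter_of :: "nat \<Rightarrow> letter" where
  "letter_of x = (if x = 1 then One else Two)"

fun next_zone :: "zone \<Rightarrow> zone" where
  "next_zone ZoneP = ZoneH"
| "next_zone ZoneH = ZoneE"
| "next_zone ZoneE = Zone1"
| "next_zone Zone1 = Zone2"
| "next_zone Zone2 = ZoneS"
| "next_zone ZoneS = ZoneS"

fun zone_for :: "letter \<Rightarrow> zone" where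
  "zone_for One = Zone1"
| "zone_for Two = Zone2"
| "zone_for Sep = ZoneS"

fun copied :: "copying \<Rightarrow> zone set" where
  "copied Prelude = {ZoneP, ZoneH}"
| "copied (Block x rest) = {ZoneP, zone_for x}"
| "copied Finale = {ZoneE}"

text \<open>The result consists of the phase after the cell, the new flag and the letter to append,
  if any. In \<open>Find\<close> every flagged cell and the first unflagged one yield a one, which
  makes \<open>i + 1\<close> ones for position \<open>i\<close>; \<open>Found\<close> outputs
  nothing and registers whether a cell follows.\<close>

fun visit :: "phase \<Rightarrow> letter \<times> bool \<Rightarrow> phase \<times> bool \<times> letter option" where
  "visit Ones (x, flag) = (Ones, flag, Some One)"
| "visit (Copy k z) (x, flag) =
     (if x = Sep then (Copy k (next_zone z), flag, None)
      else (Copy k z, flag, if z \<in> copied k then Some x else None))"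
| "visit Find (x, flag) = (if flag then (Find, True, Some One) else (Found x False, True, Some One))"
| "visit (Found y rest) (x, flag) = (Found y True, flag, None)"

fun next_phase :: "phase \<Rightarrow> phase option" where
  "next_phase Ones = Some (Copy Prelude ZoneP)"
| "next_phase (Copy Prelude z) = Some Find"
| "next_phase (Copy (Block x rest) z) = Some (if rest then Find else Copy Finale ZoneP)"
| "next_phase (Copy Finale z) = None"
| "next_phase Find = None"
| "next_phase (Found x rest) = Some (Copy (Block x rest) ZoneP)"

text \<open>A whole pass over the script without tape and head: final phase, new cells, output. The
  output can thus be computed on lists; \<open>reaches_sweep\<close> ties it to the machine.\<close>

fun sweep :: "phase \<Rightarrow> (letter \<times> bool) list \<Rightarrow> phase \<times> (letter \<times> bool) list \<times> letter list" where
  "sweep p [] = (p, [], [])"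
| "sweep p (x # xs) =
     (case visit p x of (p', flag, e) \<Rightarrow>
      case sweep p' xs of (p'', ys, out) \<Rightarrow>
        (p'', (fst x, flag) # ys, (case e of None \<Rightarrow> out | Some c \<Rightarrow> c # out)))"

text \<open>The simulation of \<open>D\<close> takes the cells of the script for blanks.\<close>

fun underlying :: "symbol \<Rightarrow> nat" where
  "underlying (Sym a) = a"
| "underlying (Cell x flag mark) = 0"

fun shift :: "direction \<Rightarrow> int \<Rightarrow> int" where
  "shift Left h = h - 1"
| "shift Right h = h + 1"

definition cells :: "(letter \<times> bool) list \<Rightarrow> symbol list" where
  "cells xs = map (\<lambda>(x, flag). Cell x flag False) xs"

definition written :: "letter list \<Rightarrow> symbol list" where
  "written out = map (\<lambda>c. Sym (digit c)) out"

definition tape_of :: "symbol list \<Rightarrow> int \<Rightarrow> symbol" where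
  "tape_of l i = (if 0 \<le> i \<and> i < int (length l) then l ! nat i else Sym 0)"

section \<open>Sweeps computed on lists\<close>

lemma sweep_append:
  "sweep p (xs @ ys) =
     (case sweep p xs of (p', xs', out) \<Rightarrow>
      case sweep p' ys of (p'', ys', out') \<Rightarrow> (p'', xs' @ ys', out @ out'))"
  by (induction xs arbitrary: p) (auto split: prod.splits option.splits)

lemma sweep_Ones: "sweep Ones xs = (Ones, xs, replicate (length xs) One)"
  by (induction xs) auto

lemma sweep_Find_flagged:
  "sweep Find (map (\<lambda>x. (x, True)) xs) =
     (Find, map (\<lambda>x. (x, True)) xs, replicate (length xs) One)"
  by (induction xs) auto

lemma sweep_Found: "sweep (Found x rest) xs = (Found x (rest \<or> xs \<noteq> []), xs, [])"
  by (induction xs arbitrary: rest) auto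

lemma sweep_Copy_zone:
  "Sep \<notin> fst ` set xs \<Longrightarrow>
   sweep (Copy k z) xs = (Copy k z, xs, if z \<in> copied k then map fst xs else [])"
  by (induction xs) auto

lemma sweep_Copy_Sep:
  "sweep (Copy k z) ((Sep, flag) # xs) =
     (case sweep (Copy k (next_zone z)) xs of (p, ys, out) \<Rightarrow> (p, (Sep, flag) # ys, out))"
  by (auto split: prod.splits)

text \<open>\<open>Z\<close> is a parameter here, since its actual value \<open>zones\<close> needs
  the table of the machine.\<close>

definition layout :: "(zone \<Rightarrow> letter list) \<Rightarrow> letter list" where
  "layout Z = Z ZoneP @ Sep # Z ZoneH @ Sep # Z ZoneE @ Sep # Z Zone1 @ Sep # Z Zone2 @ Sep # Z ZoneS"

text \<open>The script at the time when the blocks of its first \<open>i\<close> positions have been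
  started.\<close>

definition flagging :: "letter list \<Rightarrow> nat \<Rightarrow> (letter \<times> bool) list" where
  "flagging s i = map (\<lambda>x. (x, True)) (take i s) @ map (\<lambda>x. (x, False)) (drop i s)"

definition block :: "(zone \<Rightarrow> letter list) \<Rightarrow> nat \<Rightarrow> letter list" where
  "block Z i = replicate (Suc i) One @ Z ZoneP @ Z (zone_for (layout Z ! i))"

text \<open>The word \<open>1^n P H B_0 ... B_(n-1) E\<close>; for \<open>zones\<close> it turns out
  to be the code of the machine itself.\<close>

definition expansion :: "(zone \<Rightarrow> letter list) \<Rightarrow> letter list" where
  "expansion Z = replicate (length (layout Z)) One @ Z ZoneP @ Z ZoneH @
     concat (map (block Z) [0..<length (layout Z)]) @ Z ZoneE"

text \<open>Peels one zone \<open>us\<close> and its separator off the script. The flags do not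
  influence copying, hence the conditions on \<open>map fst\<close> only.\<close>

lemma sweep_Copy_cross:
  assumes "Sep \<notin> set us" and "map fst xs = us @ Sep # vs"
    and "\<And>ys. map fst ys = vs \<Longrightarrow> sweep (Copy k (next_zone z)) ys = (p, ys, out)"
  shows "sweep (Copy k z) xs = (p, xs, (if z \<in> copied k then us else []) @ out)"
proof -
  obtain as b bs where xs: "xs = as @ (Sep, b) # bs" and as: "map fst as = us" and bs: "map fst bs = vs"
    using assms(2) by (auto simp: map_eq_append_conv map_eq_Cons_conv)
  have "Sep \<notin> fst ` set as"
    using assms(1) as by auto
  then show ?thesis
    by (simp add: xs sweep_append sweep_Copy_zone sweep_Copy_Sep assms(3)[OF bs] as
        del: sweep.simps(2))
qed

text \<open>Five separators call for five crossings, one per zone; the last zone runs to the end of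
  the script.\<close>

lemma sweep_Copy_layout:
  assumes Z: "\<And>z. Sep \<notin> set (Z z)" and xs: "map fst xs = layout Z"
  shows "sweep (Copy k ZoneP) xs = (Copy k ZoneS, xs,
    concat (map (\<lambda>z. if z \<in> copied k then Z z else []) [ZoneP, ZoneH, ZoneE, Zone1, Zone2, ZoneS]))"
proof -
  have last: "sweep (Copy k ZoneS) ys = (Copy k ZoneS, ys, if ZoneS \<in> copied k then Z ZoneS else [])"
    if "map fst ys = Z ZoneS" for ys
  proof -
    have "fst ` set ys = set (Z ZoneS)"
      using that by (metis set_map)
    then show ?thesis
      using Z[of ZoneS] that by (simp add: sweep_Copy_zone)
  qed
  have "sweep (Copy k ZoneP) xs = (Copy k ZoneS, xs,
      (if ZoneP \<in> copied k then Z ZoneP else []) @ (if ZoneH \<in> copied k then Z ZoneH else []) @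
      (if ZoneE \<in> copied k then Z ZoneE else []) @ (if Zone1 \<in> copied k then Z Zone1 else []) @
      (if Zone2 \<in> copied k then Z Zone2 else []) @ (if ZoneS \<in> copied k then Z ZoneS else []))"
    by (rule sweep_Copy_cross[OF Z xs[unfolded layout_def]], unfold next_zone.simps,
        rule sweep_Copy_cross[OF Z], assumption, unfold next_zone.simps,
        rule sweep_Copy_cross[OF Z], assumption, unfold next_zone.simps,
        rule sweep_Copy_cross[OF Z], assumption, unfold next_zone.simps,
        rule sweep_Copy_cross[OF Z], assumption, unfold next_zone.simps,
        rule last)
  then show ?thesis
    by (simp del: copied.simps)
qed

lemma map_fst_flagging: "map fst (flagging s i) = s"
  by (simp add: flagging_def comp_def)

lemma length_flagging: "length (flagging s i) = length s"
  by (metis length_map map_fst_flagging)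

text \<open>The \<open>i\<close> flagged cells and the newly flagged one give a one each. The cells
  after it only turn the Boolean of \<open>Found\<close> to true, so it tells whether there are
  any.\<close>

lemma sweep_Find_flagging:
  assumes "i < length s"
  shows "sweep Find (flagging s i) =
    (Found (s ! i) (Suc i < length s), flagging s (Suc i), replicate (Suc i) One)"
proof -
  have "drop i s = s ! i # drop (Suc i) s"
    using assms by (simp add: Cons_nth_drop_Suc)
  moreover have "min (length s) i = i"
    using assms by simp
  moreover have "replicate i One @ [One] = One # replicate i One"
    by (simp add: replicate_append_same)
  ultimately show ?thesis
    using assms unfolding flagging_def
    by (auto simp: sweep_append sweep_Find_flagged sweep_Found take_Suc_conv_app_nth)
qed

section \<open>Words on tapes\<close>

lemma tape_of_append: "(tape_of l)(int (length l) := c) = tape_of (l @ [c])"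
  by (auto simp: tape_of_def fun_eq_iff nth_append)

lemma tape_of_middle: "tape_of (u @ x # v) (int (length u)) = x"
  by (simp add: tape_of_def)

lemma tape_of_update: "(tape_of (u @ x # v))(int (length u) := y) = tape_of (u @ y # v)"
  by (auto simp: tape_of_def fun_eq_iff nth_append nth_Cons split: nat.splits)

lemma tape_of_end: "tape_of l (int (length l)) = Sym 0"
  by (simp add: tape_of_def)

lemma tape_of_before: "i < 0 \<Longrightarrow> tape_of l i = Sym 0"
  by (simp add: tape_of_def)

section \<open>The machine with structured states and symbols\<close>

type_synonym typed_configuration = "control \<times> int \<times> (int \<Rightarrow> symbol)"

locale diagonal =
  fixes D :: tm
  assumes machine: "turing_machine D"
    and two_letters: "2 \<le> inputs D"
begin

text \<open>The head cannot stay in place: the end of the script is noticed on the first cell behind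
  it, and the head then moves left. \<open>Launch\<close> undoes this move, so that the simulation
  starts on the first output letter. An accepting \<open>D\<close> is turned into an endless walk to
  the right.\<close>

fun action :: "control \<Rightarrow> symbol \<Rightarrow> control \<times> symbol \<times> direction" where
  "action (Scan p) (Cell x flag mark) =
     (case visit p (x, flag) of (p', flag', e) \<Rightarrow>
      case e of None \<Rightarrow> (Scan p', Cell x flag' False, Right)
      | Some c \<Rightarrow> (Append p' c, Cell x flag' True, Right))"
| "action (Scan p) (Sym a) =
     (case next_phase p of None \<Rightarrow> Launch | Some p' \<Rightarrow> Rewind p', Sym a, Left)"
| "action (Append p c) y =
     (if y = Sym 0 then (Return p, Sym (digit c), Left) else (Append p c, y, Right))"
| "action (Return p) (Cell x flag mark) =
     (if mark then (Scan p, Cell x flag False, Right) else (Return p, Cell x flag mark, Left))"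
| "action (Return p) (Sym a) = (Return p, Sym a, Left)"
| "action (Rewind p) y = (if y = Sym 0 then (Scan p, y, Right) else (Rewind p, y, Left))"
| "action Launch y = (Simulate (start_state D), y, Right)"
| "action (Simulate q) y =
     (if q = accept_state D then (Simulate q, y, Right)
      else if q = reject_state D then (Accept, y, Right)
      else case trans D q (underlying y) of (q', a, d) \<Rightarrow> (Simulate q', Sym a, d))"
| "action Accept y = (Accept, y, Right)"
| "action Reject y = (Reject, y, Right)"

fun move :: "typed_configuration \<Rightarrow> typed_configuration" where
  "move (q, h, t) =
     (if q = Accept \<or> q = Reject then (q, h, t)
      else case action q (t h) of (q', a, d) \<Rightarrow> (q', shift d h, t(h := a)))"

definition reaches :: "typed_configuration \<Rightarrow> typed_configuration \<Rightarrow> bool" where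
  "reaches c c' \<longleftrightarrow> (\<exists>t. (move ^^ t) c = c')"

lemma reaches_refl: "reaches c c"
  unfolding reaches_def by (rule exI[of _ 0]) simp

lemma reaches_trans [trans]:
  assumes "reaches a b" "reaches b c"
  shows "reaches a c"
proof -
  from assms obtain s t where "(move ^^ s) a = b" "(move ^^ t) b = c"
    by (auto simp: reaches_def)
  then have "(move ^^ (t + s)) a = c"
    by (simp add: funpow_add)
  then show ?thesis
    unfolding reaches_def by blast
qed

lemma reaches_move: "move a = b \<Longrightarrow> reaches a b"
  unfolding reaches_def by (rule exI[of _ 1]) simp

lemma reaches_moveI: "move a = b \<Longrightarrow> reaches b c \<Longrightarrow> reaches a c"
  using reaches_move reaches_trans by blast

section \<open>Head movements that realise a sweep\<close>

text \<open>As \<open>v\<close> has no blank, the first blank met lies just behind it. After writing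
  there the head must step left, whence the \<open>- 1\<close>.\<close>

lemma reaches_Append:
  assumes "Sym 0 \<notin> set v"
  shows "reaches (Append p c, int (length u), tape_of (u @ v))
    (Return p, int (length u + length v) - 1, tape_of (u @ v @ [Sym (digit c)]))"
  using assms
proof (induction v arbitrary: u)
  case Nil
  show ?case
    by (rule reaches_move) (simp add: tape_of_end tape_of_append)
next
  case (Cons x v)
  have "reaches (Append p c, int (length (u @ [x])), tape_of ((u @ [x]) @ v))
      (Return p, int (length (u @ [x]) + length v) - 1, tape_of ((u @ [x]) @ v @ [Sym (digit c)]))"
    using Cons by (intro Cons.IH) auto
  then have "reaches (Append p c, int (length u) + 1, tape_of (u @ x # v))
      (Return p, int (length u + length (x # v)) - 1, tape_of (u @ (x # v) @ [Sym (digit c)]))"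
    by (simp add: add.commute add.left_commute)
  moreover have "move (Append p c, int (length u), tape_of (u @ x # v)) =
      (Append p c, int (length u) + 1, tape_of (u @ x # v))"
    using Cons.prems by (auto simp: tape_of_middle)
  ultimately show ?case
    by (blast intro: reaches_moveI)
qed

text \<open>No other mark lies between, so the first mark met on the way left is the right one. The
  head moves left, hence the induction from the right end of \<open>v\<close>.\<close>

lemma reaches_Return:
  assumes "\<forall>x flag. Cell x flag True \<notin> set v"
  shows "reaches (Return p, int (length u + length v), tape_of (u @ Cell x flag True # v @ w))
    (Scan p, int (length u) + 1, tape_of (u @ Cell x flag False # v @ w))"
  using assms
proof (induction v arbitrary: w rule: rev_induct)
  case Nil
  show ?case
    by (rule reaches_move) (simp add: tape_of_middle tape_of_update)
next
  case (snoc y v)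
  have *: "reaches (Return p, int (length u + length v), tape_of (u @ Cell x flag True # v @ y # w))
      (Scan p, int (length u) + 1, tape_of (u @ Cell x flag False # v @ y # w))"
    using snoc by auto
  have "action (Return p) y = (Return p, y, Left)"
    using snoc.prems by (cases y) auto
  then have "move (Return p, int (length (u @ Cell x flag True # v)),
        tape_of ((u @ Cell x flag True # v) @ y # w)) =
      (Return p, int (length (u @ Cell x flag True # v)) - 1,
        tape_of ((u @ Cell x flag True # v) @ y # w))"
    by (simp only: move.simps tape_of_middle tape_of_update) simp
  moreover have "reaches (Return p, int (length (u @ Cell x flag True # v)) - 1,
        tape_of ((u @ Cell x flag True # v) @ y # w))
      (Scan p, int (length u) + 1, tape_of (u @ Cell x flag False # (v @ [y]) @ w))"
    using * by simp
  ultimately have "reaches (Return p, int (length (u @ Cell x flag True # v)),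
        tape_of ((u @ Cell x flag True # v) @ y # w))
      (Scan p, int (length u) + 1, tape_of (u @ Cell x flag False # (v @ [y]) @ w))"
    by (rule reaches_moveI)
  then show ?case
    by simp
qed

text \<open>The first blank to the left is at position \<open>-1\<close>, and the step right from
  there ends at \<open>0\<close>.\<close>

lemma reaches_Rewind:
  assumes "Sym 0 \<notin> set u"
  shows "reaches (Rewind p, int (length u) - 1, tape_of (u @ v)) (Scan p, 0, tape_of (u @ v))"
  using assms
proof (induction u arbitrary: v rule: rev_induct)
  case Nil
  show ?case
    by (rule reaches_move) (simp add: tape_of_before fun_upd_idem)
next
  case (snoc y u)
  then have "reaches (Rewind p, int (length u) - 1, tape_of (u @ y # v)) (Scan p, 0, tape_of (u @ y # v))"
    by simp
  moreover have "move (Rewind p, int (length u), tape_of (u @ y # v)) =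
      (Rewind p, int (length u) - 1, tape_of (u @ y # v))"
    using snoc.prems by (auto simp: tape_of_middle)
  ultimately have "reaches (Rewind p, int (length u), tape_of (u @ y # v))
      (Scan p, 0, tape_of (u @ y # v))"
    by (rule reaches_moveI[rotated])
  then show ?case
    by simp
qed

lemma blank_notin_cells: "Sym 0 \<notin> set (cells xs)"
  by (auto simp: cells_def)

lemma blank_notin_written: "Sym 0 \<notin> set (written out)"
proof -
  have "digit c \<noteq> 0" for c
    by (cases c) auto
  then show ?thesis
    by (metis (no_types, lifting) written_def ex_map_conv symbol.inject(1))
qed

text \<open>Induction over the cells \<open>ys\<close> still ahead; \<open>xs\<close> has been
  passed and carries its new flags, \<open>out\<close> has been output so far.\<close>

lemma reaches_sweep:
  assumes "sweep p ys = (p', ys', new)"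
  shows "reaches (Scan p, int (length xs), tape_of (cells (xs @ ys) @ written out))
    (Scan p', int (length xs + length ys), tape_of (cells (xs @ ys') @ written (out @ new)))"
  using assms
proof (induction ys arbitrary: p p' ys' new xs out)
  case Nil
  then show ?case
    by (simp add: reaches_refl)
next
  case (Cons y ys)
  obtain x flag where y: "y = (x, flag)"
    by fastforce
  obtain q flag' e where v: "visit p (x, flag) = (q, flag', e)"
    by (metis prod_cases3)
  obtain p'' zs new' where s: "sweep q ys = (p'', zs, new')"
    by (metis prod_cases3)
  have p'': "p'' = p'" and ys': "ys' = (x, flag') # zs"
    and new: "new = (case e of None \<Rightarrow> new' | Some c \<Rightarrow> c # new')"
    using Cons.prems by (simp_all add: y v s)
  define u where "u = cells xs"
  define w where "w = cells ys"
  have u: "length u = length xs" and w: "length w = length ys"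
    by (simp_all add: u_def w_def cells_def)
  have start: "cells (xs @ y # ys) @ written out = u @ Cell x flag False # w @ written out"
    by (simp add: u_def w_def y cells_def)
  let ?out = "case e of None \<Rightarrow> out | Some c \<Rightarrow> out @ [c]"
  \<comment> \<open>Treatment of one cell: a single move if nothing is output; otherwise the cell is
    marked, the letter is carried behind the output, and the head returns to the mark and clears
    it.\<close>
  have one: "reaches (Scan p, int (length u), tape_of (u @ Cell x flag False # w @ written out))
      (Scan q, int (length u) + 1, tape_of (u @ Cell x flag' False # w @ written ?out))"
  proof (cases e)
    case None
    then show ?thesis
      by (intro reaches_move) (simp add: tape_of_middle tape_of_update v)
  next
    case (Some c)
    let ?v = "w @ written out"
    have "reaches (Scan p, int (length u), tape_of (u @ Cell x flag False # ?v))
        (Append q c, int (length (u @ [Cell x flag' True])), tape_of ((u @ [Cell x flag' True]) @ ?v))"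
      by (rule reaches_move) (simp add: tape_of_middle tape_of_update v Some)
    also have "reaches \<dots> (Return q, int (length (u @ [Cell x flag' True]) + length ?v) - 1,
        tape_of ((u @ [Cell x flag' True]) @ ?v @ [Sym (digit c)]))"
      using blank_notin_cells blank_notin_written
      by (intro reaches_Append) (auto simp: w_def)
    also have "\<dots> = (Return q, int (length u + length ?v),
        tape_of (u @ Cell x flag' True # ?v @ [Sym (digit c)]))"
      by simp
    also have "reaches \<dots> (Scan q, int (length u) + 1,
        tape_of (u @ Cell x flag' False # ?v @ [Sym (digit c)]))"
      by (intro reaches_Return) (auto simp: w_def cells_def written_def)
    finally show ?thesis
      by (simp add: written_def Some)
  qed
  have "reaches (Scan q, int (length (xs @ [(x, flag')])),
      tape_of (cells ((xs @ [(x, flag')]) @ ys) @ written ?out))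
    (Scan p'', int (length (xs @ [(x, flag')]) + length ys),
      tape_of (cells ((xs @ [(x, flag')]) @ zs) @ written (?out @ new')))"
    by (rule Cons.IH[OF s])
  moreover have "cells ((xs @ [(x, flag')]) @ ys) = u @ Cell x flag' False # w"
    by (simp add: u_def w_def cells_def)
  moreover have "cells ((xs @ [(x, flag')]) @ zs) = cells (xs @ ys')"
    by (simp add: ys')
  moreover have "?out @ new' = out @ new"
    by (simp add: new split: option.split)
  ultimately have "reaches (Scan q, int (length u) + 1,
      tape_of (u @ Cell x flag' False # w @ written ?out))
    (Scan p', int (length xs + length (y # ys)), tape_of (cells (xs @ ys') @ written (out @ new)))"
    by (simp add: p'' u add_ac)
  from reaches_trans[OF one this] show ?case
    by (simp only: start u)
qed

lemma reaches_pass: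
  assumes "sweep p xs = (p', ys, new)" and "next_phase p' = Some p''"
  shows "reaches (Scan p, 0, tape_of (cells xs @ written out))
    (Scan p'', 0, tape_of (cells ys @ written (out @ new)))"
proof -
  have length: "length ys = length xs"
    using assms(1)
    by (induction xs arbitrary: p ys new) (auto split: prod.splits)
  let ?t = "tape_of (cells ys @ written (out @ new))"
  have n: "length (cells ys) = length xs"
    by (simp add: cells_def length)
  \<comment> \<open>Behind the script stands the first output letter or, without output, a blank: in
    both cases a \<open>Sym\<close>, which ends the sweep.\<close>
  obtain a where a: "?t (int (length xs)) = Sym a"
    using n tape_of_end[of "cells ys"] tape_of_middle[of "cells ys"]
    by (cases "out @ new") (simp_all add: written_def)
  have "reaches (Scan p, 0, tape_of (cells xs @ written out)) (Scan p', int (length xs), ?t)"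
    using reaches_sweep[OF assms(1), of "[]" out] by simp
  also have "reaches \<dots> (Rewind p'', int (length (cells ys)) - 1, ?t)"
    by (rule reaches_move) (use a assms(2) n in \<open>simp add: fun_upd_idem\<close>)
  also have "reaches \<dots> (Scan p'', 0, ?t)"
    by (rule reaches_Rewind[OF blank_notin_cells])
  finally show ?thesis .
qed

lemma reaches_last_pass:
  assumes "sweep p xs = (p', ys, new)" and "next_phase p' = None"
  shows "reaches (Scan p, 0, tape_of (cells xs @ written out))
    (Simulate (start_state D), int (length xs), tape_of (cells ys @ written (out @ new)))"
proof -
  have length: "length ys = length xs"
    using assms(1)
    by (induction xs arbitrary: p ys new) (auto split: prod.splits)
  let ?t = "tape_of (cells ys @ written (out @ new))"
  have n: "length (cells ys) = length xs"
    by (simp add: cells_def length)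
  obtain a where a: "?t (int (length xs)) = Sym a"
    using n tape_of_end[of "cells ys"] tape_of_middle[of "cells ys"]
    by (cases "out @ new") (simp_all add: written_def)
  have "reaches (Scan p, 0, tape_of (cells xs @ written out)) (Scan p', int (length xs), ?t)"
    using reaches_sweep[OF assms(1), of "[]" out] by simp
  also have "reaches \<dots> (Launch, int (length xs) - 1, ?t)"
    by (rule reaches_move) (use a assms(2) n in \<open>simp add: fun_upd_idem\<close>)
  also have "reaches \<dots> (Simulate (start_state D), int (length xs), ?t)"
    by (rule reaches_move) (simp add: fun_upd_idem)
  finally show ?thesis .
qed

section \<open>The complete expansion of a script\<close>

context
  fixes Z :: "zone \<Rightarrow> letter list"
  assumes Z: "\<And>z. Sep \<notin> set (Z z)"
begin

text \<open>Each block takes two sweeps: \<open>Find\<close> outputs \<open>1^(i+1)\<close> and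
  fetches the letter at position \<open>i\<close>, then \<open>Copy\<close> outputs
  \<open>P Z\<close> for that letter.\<close>

lemma reaches_blocks:
  assumes "i < length (layout Z)"
  shows "reaches (Scan Find, 0, tape_of (cells (flagging (layout Z) i) @ written out))
    (Scan (Copy Finale ZoneP), 0, tape_of (cells (flagging (layout Z) (length (layout Z))) @
      written (out @ concat (map (block Z) [i..<length (layout Z)]))))"
  using assms
proof (induction "length (layout Z) - i" arbitrary: i out)
  case 0
  then show ?case by simp
next
  case (Suc m)
  let ?s = "layout Z"
  let ?p = "Copy (Block (?s ! i) (Suc i < length ?s))"
  let ?cells = "cells (flagging ?s (Suc i))"
  have upt: "[i..<length ?s] = i # [Suc i..<length ?s]"
    using Suc.prems by (rule upt_conv_Cons)
  have "reaches (Scan Find, 0, tape_of (cells (flagging ?s i) @ written out))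
      (Scan (?p ZoneP), 0, tape_of (?cells @ written (out @ replicate (Suc i) One)))"
    using Suc.prems by (intro reaches_pass[OF sweep_Find_flagging]) simp_all
  also have "reaches \<dots> (Scan (if Suc i < length ?s then Find else Copy Finale ZoneP), 0,
      tape_of (?cells @ written ((out @ replicate (Suc i) One) @ concat (map (\<lambda>z. if z \<in> copied
        (Block (?s ! i) (Suc i < length ?s)) then Z z else []) [ZoneP, ZoneH, ZoneE, Zone1, Zone2, ZoneS]))))"
    by (rule reaches_pass[OF sweep_Copy_layout[OF Z map_fst_flagging]]) simp
  \<comment> \<open>\<open>ZoneP\<close> precedes all zones of the form \<open>zone_for x\<close>,
    so the two copied words come out in the order required.\<close>
  also have "(out @ replicate (Suc i) One) @ concat (map (\<lambda>z. if z \<in> copied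
        (Block (?s ! i) (Suc i < length ?s)) then Z z else []) [ZoneP, ZoneH, ZoneE, Zone1, Zone2, ZoneS]) =
      out @ block Z i"
    by (cases "?s ! i") (simp_all add: block_def)
  finally have one: "reaches (Scan Find, 0, tape_of (cells (flagging ?s i) @ written out))
      (Scan (if Suc i < length ?s then Find else Copy Finale ZoneP), 0,
        tape_of (?cells @ written (out @ block Z i)))" .
  show ?case
  proof (cases "Suc i < length ?s")
    case True
    have "m = length ?s - Suc i"
      using Suc.hyps(2) by simp
    from Suc.hyps(1)[OF this True, of "out @ block Z i"] one True show ?thesis
      by (auto simp: upt intro: reaches_trans)
  next
    case False
    then have "Suc i = length ?s"
      using Suc.prems by simp
    then show ?thesis
      using one by (simp add: upt)
  qed
qed

lemma reaches_expansion:
  "reaches (Scan Ones, 0, tape_of (cells (flagging (layout Z) 0)))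
    (Simulate (start_state D), int (length (layout Z)),
      tape_of (cells (flagging (layout Z) (length (layout Z))) @ written (expansion Z)))"
proof -
  let ?s = "layout Z"
  let ?n = "length ?s"
  let ?ones = "replicate ?n One"
  \<comment> \<open>The separators make the script nonempty, so the first \<open>Find\<close> sweep
    does find an unflagged cell.\<close>
  have pos: "0 < ?n"
    by (simp add: layout_def)
  have "reaches (Scan Ones, 0, tape_of (cells (flagging ?s 0) @ written []))
      (Scan (Copy Prelude ZoneP), 0, tape_of (cells (flagging ?s 0) @ written ([] @ ?ones)))"
    by (rule reaches_pass[OF sweep_Ones[of "flagging ?s 0", unfolded length_flagging]]) simp
  also have "reaches \<dots> (Scan Find, 0, tape_of (cells (flagging ?s 0) @
      written (([] @ ?ones) @ concat (map (\<lambda>z. if z \<in> copied Prelude then Z z else [])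
        [ZoneP, ZoneH, ZoneE, Zone1, Zone2, ZoneS]))))"
    by (rule reaches_pass[OF sweep_Copy_layout[OF Z map_fst_flagging]]) simp
  also have "([] @ ?ones) @ concat (map (\<lambda>z. if z \<in> copied Prelude then Z z else [])
        [ZoneP, ZoneH, ZoneE, Zone1, Zone2, ZoneS]) = ?ones @ Z ZoneP @ Z ZoneH"
    by simp
  also have "reaches (Scan Find, 0, tape_of (cells (flagging ?s 0) @ written (?ones @ Z ZoneP @ Z ZoneH)))
      (Scan (Copy Finale ZoneP), 0, tape_of (cells (flagging ?s ?n) @
        written ((?ones @ Z ZoneP @ Z ZoneH) @ concat (map (block Z) [0..<?n]))))"
    by (rule reaches_blocks[OF pos])
  also have "reaches \<dots> (Simulate (start_state D), int (length (flagging ?s ?n)),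
      tape_of (cells (flagging ?s ?n) @
        written (((?ones @ Z ZoneP @ Z ZoneH) @ concat (map (block Z) [0..<?n])) @
          concat (map (\<lambda>z. if z \<in> copied Finale then Z z else [])
            [ZoneP, ZoneH, ZoneE, Zone1, Zone2, ZoneS]))))"
    by (rule reaches_last_pass[OF sweep_Copy_layout[OF Z map_fst_flagging]]) simp
  finally show ?thesis
    by (simp add: written_def expansion_def length_flagging)
qed

end

section \<open>Simulation of the decider\<close>

text \<open>The tape of \<open>D\<close> is displaced by \<open>n\<close>, the length of the script.
  Comparing \<open>underlying\<close> symbols lets a script cell count as a blank until
  \<open>D\<close> overwrites it.\<close>

definition simulates :: "int \<Rightarrow> configuration \<Rightarrow> typed_configuration \<Rightarrow> bool" where
  "simulates n c x \<longleftrightarrow> (\<exists>t. x = (Simulate (state c), head c + n, t) \<and>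
     (\<forall>i. underlying (t (i + n)) = tape c i))"

text \<open>A halted \<open>D\<close> is matched by no move at all, any other step by exactly
  one.\<close>

lemma simulates_step:
  assumes "simulates n c x"
  shows "\<exists>y. reaches x y \<and> simulates n (step D c) y"
proof (cases "halting_state D (state c)")
  case True
  then show ?thesis
    using assms by (intro exI[of _ x]) (simp add: reaches_refl step_def)
next
  case False
  obtain t where x: "x = (Simulate (state c), head c + n, t)"
    and t: "\<And>i. underlying (t (i + n)) = tape c i"
    using assms by (auto simp: simulates_def)
  obtain q a d where tr: "trans D (state c) (tape c (head c)) = (q, a, d)"
    by (metis prod_cases3)
  have "move x = (Simulate q, shift d (head c + n), t(head c + n := Sym a))"
    using False t[of "head c"] tr by (simp add: x halting_state_def)
  moreover have "simulates n (step D c) (Simulate q, shift d (head c + n), t(head c + n := Sym a))"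
    using False t by (cases d) (auto simp: simulates_def step_def tr)
  ultimately show ?thesis
    using reaches_move by blast
qed

lemma simulates_run:
  assumes "simulates n (initial D w) x"
  shows "\<exists>y. reaches x y \<and> simulates n (run D w t) y"
proof (induction t)
  case 0
  then show ?case
    using assms by (intro exI[of _ x]) (simp add: reaches_refl run_def)
next
  case (Suc t)
  then show ?case
    using simulates_step reaches_trans unfolding run_def funpow.simps comp_apply by meson
qed

section \<open>Numbering of states and symbols\<close>

text \<open>The type \<open>control\<close> is infinite because of \<open>Simulate\<close>; this
  finite set is closed under \<open>action\<close>.\<close>

definition controls :: "control set" where
  "controls = {Accept, Reject, Launch} \<union> range Scan \<union> (\<Union>p. range (Append p)) \<union> range Return \<union>
     range Rewind \<union> Simulate ` {..<states D}"

definition alphabet :: "symbol set" where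
  "alphabet = {y. \<forall>a. y = Sym a \<longrightarrow> a < symbols D}"

definition code :: "control \<Rightarrow> nat" where
  "code = (SOME f. bij_betw f controls {0..<card controls})"

definition decode :: "nat \<Rightarrow> control" where
  "decode = inv_into controls code"

fun letter_index :: "letter \<Rightarrow> nat" where
  "letter_index One = 0"
| "letter_index Two = 1"
| "letter_index Sep = 2"

text \<open>The symbols of \<open>D\<close> keep their numbers, so the blank stays \<open>0\<close>;
  the twelve cells follow, four for each letter.\<close>

fun symbol_code :: "symbol \<Rightarrow> nat" where
  "symbol_code (Sym a) = a"
| "symbol_code (Cell x flag mark) =
     symbols D + (4 * letter_index x + 2 * of_bool flag + of_bool mark)"

definition decode_symbol :: "nat \<Rightarrow> symbol" where
  "decode_symbol a =
     (if a < symbols D then Sym a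
      else let r = a - symbols D in
        Cell (if r < 4 then One else if r < 8 then Two else Sep) (2 \<le> r mod 4) (odd r))"

lemma finite_controls: "finite controls"
proof -
  have "x \<in> {One, Two, Sep}" for x :: letter
    by (cases x) auto
  then have letter: "finite (UNIV :: letter set)"
    by (rule finite_subset[OF subsetI]) (simp)
  have "x \<in> {ZoneP, ZoneH, ZoneE, Zone1, Zone2, ZoneS}" for x :: zone
    by (cases x) auto
  then have zone: "finite (UNIV :: zone set)"
    by (rule finite_subset[OF subsetI]) (simp)
  have "x \<in> {Prelude, Finale} \<union> (\<Union>x. range (Block x))" for x :: copying
    by (cases x) auto
  then have copying: "finite (UNIV :: copying set)"
    by (rule finite_subset[OF subsetI]) (simp add: letter)
  have "x \<in> {Ones, Find} \<union> (\<Union>k. range (Copy k)) \<union> (\<Union>x. range (Found x))" for x :: phase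
    by (cases x) (auto simp: image_iff)
  then have phase: "finite (UNIV :: phase set)"
    by (rule finite_subset[OF subsetI]) (simp add: letter zone copying)
  show ?thesis
    by (simp add: controls_def letter phase)
qed

lemma bij_code: "bij_betw code controls {0..<card controls}"
  unfolding code_def by (rule someI_ex[OF ex_bij_betw_finite_nat[OF finite_controls]])

lemma code_less: "q \<in> controls \<Longrightarrow> code q < card controls"
  using bij_code by (auto simp: bij_betw_def)

lemma code_eq_iff: "q \<in> controls \<Longrightarrow> r \<in> controls \<Longrightarrow> code q = code r \<longleftrightarrow> q = r"
  using bij_code by (auto simp: bij_betw_def inj_on_eq_iff)

lemma decode_code: "q \<in> controls \<Longrightarrow> decode (code q) = q"
  using bij_code by (auto simp: decode_def bij_betw_def)

lemma decode_in_controls: "i < card controls \<Longrightarrow> decode i \<in> controls"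
  using bij_code unfolding decode_def bij_betw_def by (intro inv_into_into) auto

lemma code_decode: "i < card controls \<Longrightarrow> code (decode i) = i"
  using bij_code unfolding decode_def bij_betw_def by (intro f_inv_into_f) auto

lemma symbol_code_less: "y \<in> alphabet \<Longrightarrow> symbol_code y < symbols D + 12"
proof (cases y)
  case (Cell x flag mark)
  then show ?thesis by (cases x) auto
qed (auto simp: alphabet_def)

lemma decode_symbol_in_alphabet: "decode_symbol a \<in> alphabet"
  by (auto simp: decode_symbol_def alphabet_def Let_def)

lemma decode_symbol_code: "y \<in> alphabet \<Longrightarrow> decode_symbol (symbol_code y) = y"
proof (cases y)
  case (Cell x flag mark)
  then show ?thesis
    by (cases x; cases flag; cases mark) (auto simp: decode_symbol_def)
qed (auto simp: alphabet_def decode_symbol_def)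

lemma in_controls [simp]:
  "Accept \<in> controls" "Reject \<in> controls" "Launch \<in> controls" "Scan p \<in> controls"
  "Append p c \<in> controls" "Return p \<in> controls" "Rewind p \<in> controls"
  "Simulate q \<in> controls \<longleftrightarrow> q < states D"
  by (simp_all add: controls_def image_iff)

text \<open>For \<open>Simulate\<close> this is the closure of the table of \<open>D\<close>; for
  \<open>Append\<close> it rests on \<open>1\<close> and \<open>2\<close> being symbols of
  \<open>D\<close>.\<close>

lemma action_closed:
  assumes "q \<in> controls" "q \<noteq> Accept" "q \<noteq> Reject" "y \<in> alphabet" "action q y = (q', a, d)"
  shows "q' \<in> controls \<and> a \<in> alphabet"
proof -
  have symbols: "2 < symbols D" and "start_state D < states D"
    using machine two_letters by (auto simp: turing_machine_def)
  have digit: "digit c < symbols D" for c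
    using symbols by (cases c) auto
  have underlying: "underlying y < symbols D"
    using assms(4) symbols by (cases y) (auto simp: alphabet_def)
  show ?thesis
  proof (cases q)
    case (Scan p)
    then show ?thesis
      using assms by (cases y) (auto simp: alphabet_def split: prod.splits option.splits)
  next
    case (Append p c)
    then show ?thesis
      using assms digit by (auto simp: alphabet_def split: if_splits)
  next
    case (Return p)
    then show ?thesis
      using assms by (cases y) (auto simp: alphabet_def split: if_splits)
  next
    case (Simulate r)
    have r: "r < states D"
      using assms(1) by (simp add: Simulate)
    have "q'' < states D \<and> b < symbols D"
      if "trans D r (underlying y) = (q'', b, d')" "\<not> halting_state D r" for q'' b d'
      using that machine r underlying unfolding turing_machine_def by fastforce
    then show ?thesis
      using assms Simulate r
      by (auto simp: alphabet_def halting_state_def split: if_splits prod.splits)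
  qed (use assms \<open>start_state D < states D\<close> in
      \<open>auto split: if_splits\<close>)
qed

section \<open>The diagonal machine and its script\<close>

definition body :: "nat \<Rightarrow> nat \<Rightarrow> nat \<times> nat \<times> direction" where
  "body q a =
     (case action (decode q) (decode_symbol a) of (q', a', d) \<Rightarrow> (code q', symbol_code a', d))"

text \<open>State \<open>card controls + i\<close> writes \<open>s ! i\<close>, and the last state
  turns back. As \<open>1\<close> is the only input letter, a nonempty input is recognised by its
  first symbol and accepted at once.\<close>

definition writer :: "letter list \<Rightarrow> tm" where
  "writer s = \<lparr>states = card controls + length s + 1, symbols = symbols D + 12, inputs = 1,
     start_state = card controls, accept_state = code Accept, reject_state = code Reject,
     trans = (\<lambda>q a.
       if q < card controls then body q a
       else if a \<noteq> 0 then (code Accept, 0, Right)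
       else if q < card controls + length s then
         (q + 1, symbol_code (Cell (s ! (q - card controls)) False False), Right)
       else (code (Rewind Ones), 0, Left))\<rparr>"

text \<open>The part of a row outside \<open>controls\<close> that belongs to the nonblank symbols,
  of which there are \<open>symbols D + 11\<close>.\<close>

definition default_entries :: "nat list" where
  "default_entries = concat (replicate (symbols D + 11) (encode_entry (code Accept, 0, Right)))"

text \<open>The word \<open>Z\<close>. Its leading \<open>2\<close> closes the unary number of the
  next state, whose ones are \<open>1^(i+1) P\<close>; the other single \<open>2\<close> is the
  direction \<open>Right\<close>.\<close>

definition letter_entry :: "letter \<Rightarrow> nat list" where
  "letter_entry x = [2] @ unary (symbol_code (Cell x False False)) @ [2] @ default_entries"

text \<open>\<open>H\<close> opens with \<open>1, 2\<close> because the number of states is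
  \<open>n + b + 1\<close>, of which \<open>1^n P\<close> supplies only \<open>n + b\<close>
  ones.\<close>

fun zone_text :: "zone \<Rightarrow> nat list" where
  "zone_text ZoneP = replicate (card controls) 1"
| "zone_text ZoneH = [1, 2] @ unary (symbols D + 12) @ unary 1 @ unary (card controls) @
     unary (code Accept) @ unary (code Reject) @
     concat (map (\<lambda>q. if q = code Accept \<or> q = code Reject then []
       else concat (map (\<lambda>a. encode_entry (body q a)) [0..<symbols D + 12])) [0..<card controls])"
| "zone_text ZoneE = encode_entry (code (Rewind Ones), 0, Left) @ default_entries"
| "zone_text Zone1 = letter_entry One"
| "zone_text Zone2 = letter_entry Two"
| "zone_text ZoneS = letter_entry Sep"

definition zones :: "zone \<Rightarrow> letter list" where
  "zones z = map letter_of (zone_text z)"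

text \<open>There is no circularity: \<open>zones\<close> is made from \<open>card controls\<close>,
  \<open>code\<close>, \<open>symbol_code\<close> and \<open>body\<close>, none of which mentions
  the script.\<close>

definition diagonal_machine :: tm where
  "diagonal_machine = writer (layout zones)"

lemma Sep_notin_zones: "Sep \<notin> set (zones z)"
  by (auto simp: zones_def letter_of_def)

lemma blank_in_alphabet: "Sym 0 \<in> alphabet"
  using machine by (auto simp: alphabet_def turing_machine_def)

lemma writer_simps [simp]:
  "states (writer s) = card controls + length s + 1" "symbols (writer s) = symbols D + 12"
  "inputs (writer s) = 1" "start_state (writer s) = card controls"
  "accept_state (writer s) = code Accept" "reject_state (writer s) = code Reject"
  by (simp_all add: writer_def)

lemma trans_writer:
  "trans (writer s) q a =
     (if q < card controls then body q a
      else if a \<noteq> 0 then (code Accept, 0, Right)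
      else if q < card controls + length s then
        (q + 1, symbol_code (Cell (s ! (q - card controls)) False False), Right)
      else (code (Rewind Ones), 0, Left))"
  by (simp add: writer_def)

lemma turing_machine_writer: "turing_machine (writer s)"
proof -
  have symbols: "2 < symbols D"
    using machine two_letters by (auto simp: turing_machine_def)
  have closed: "code q' < card controls \<and> symbol_code a' < symbols D + 12"
    if q: "q < card controls" "q \<noteq> code Accept" "q \<noteq> code Reject"
      and step: "action (decode q) (decode_symbol a) = (q', a', d)" for q a q' a' d
  proof -
    have "decode q \<noteq> Accept" "decode q \<noteq> Reject"
      using q code_decode[OF q(1)] by auto
    from action_closed[OF decode_in_controls[OF q(1)] this decode_symbol_in_alphabet step]
    show ?thesis
      using code_less symbol_code_less by blast
  qed
  have cell: "symbol_code (Cell x False False) < symbols D + 12" for x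
    by (rule symbol_code_less) (simp add: alphabet_def)
  have entry: "case trans (writer s) q a of (q', a', d) \<Rightarrow> q' < states (writer s) \<and> a' < symbols (writer s)"
    if "q < states (writer s)" "a < symbols (writer s)" "\<not> halting_state (writer s) q" for q a
  proof (cases "q < card controls")
    case True
    obtain q' a' d where step: "action (decode q) (decode_symbol a) = (q', a', d)"
      by (metis prod_cases3)
    have "q \<noteq> code Accept" "q \<noteq> code Reject"
      using that(3) by (auto simp: halting_state_def)
    from closed[OF True this step] True step show ?thesis
      by (simp add: trans_writer body_def)
  next
    case False
    then show ?thesis
      using that code_less[of Accept] code_less[of "Rewind Ones"] cell
      by (simp add: trans_writer del: symbol_code.simps)
  qed
  have "code Accept \<noteq> code Reject"
    by (simp add: code_eq_iff)
  then show ?thesis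
    unfolding turing_machine_def
    using symbols code_less[of Accept] code_less[of Reject] entry
    by (intro conjI allI impI) simp_all
qed

section \<open>Agreement of the numbered and the structured runs\<close>

lemma halting_writer:
  "q \<in> controls \<Longrightarrow> halting_state (writer s) (code q) \<longleftrightarrow> q = Accept \<or> q = Reject"
  by (simp add: halting_state_def trans_writer code_eq_iff)

text \<open>Membership in \<open>controls\<close> and \<open>alphabet\<close> makes the numbering
  invertible along the run.\<close>

definition represents :: "configuration \<Rightarrow> typed_configuration \<Rightarrow> bool" where
  "represents c x \<longleftrightarrow> (\<exists>q h t. x = (q, h, t) \<and> q \<in> controls \<and> range t \<subseteq> alphabet \<and>
     c = \<lparr>state = code q, head = h, tape = symbol_code \<circ> t\<rparr>)"

lemma represents_step:
  assumes "represents c x"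
  shows "represents (step (writer s) c) (move x)"
proof -
  obtain q h t where x: "x = (q, h, t)" and q: "q \<in> controls" and t: "range t \<subseteq> alphabet"
    and c: "c = \<lparr>state = code q, head = h, tape = symbol_code \<circ> t\<rparr>"
    using assms unfolding represents_def by blast
  show ?thesis
  proof (cases "q = Accept \<or> q = Reject")
    case True
    then show ?thesis
      using assms by (simp add: x c step_def halting_writer[OF q])
  next
    case False
    obtain q' a d where act: "action q (t h) = (q', a, d)"
      by (metis prod_cases3)
    have th: "t h \<in> alphabet"
      using t by auto
    have closed: "q' \<in> controls" "a \<in> alphabet"
      using action_closed[OF q _ _ th act] False by auto
    have "body (code q) (symbol_code (t h)) = (code q', symbol_code a, d)"
      by (simp add: body_def decode_code[OF q] decode_symbol_code[OF th] act)
    then have "step (writer s) c =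
        \<lparr>state = code q', head = shift d h, tape = symbol_code \<circ> t(h := a)\<rparr>"
      using False code_less[OF q]
      by (cases d) (auto simp: c step_def halting_writer[OF q] trans_writer)
    moreover have "range (t(h := a)) \<subseteq> alphabet"
      using t closed by auto
    ultimately show ?thesis
      using False closed act by (auto simp: represents_def x)
  qed
qed

lemma represents_run:
  assumes "represents (run (writer s) w t) x" and "reaches x y"
  shows "\<exists>t'. represents (run (writer s) w t') y"
proof -
  obtain m where y: "(move ^^ m) x = y"
    using assms(2) by (auto simp: reaches_def)
  have "represents (run (writer s) w (m + t)) ((move ^^ m) x)"
  proof (induction m)
    case 0
    then show ?case using assms(1) by simp
  next
    case (Suc m)
    then show ?case
      using represents_step by (simp add: run_def)
  qed
  then show ?thesis
    using y by blast
qed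

text \<open>On the empty input every writing state meets a blank, for the head always stands just
  behind what has been written.\<close>

lemma run_writer:
  assumes "i \<le> length s"
  shows "run (writer s) [] i = \<lparr>state = card controls + i, head = int i,
    tape = symbol_code \<circ> tape_of (map (\<lambda>x. Cell x False False) (take i s))\<rparr>"
  using assms
proof (induction i)
  case 0
  then show ?case
    by (auto simp: run_def initial_def trans_writer tape_of_def comp_def)
next
  case (Suc i)
  have "\<not> halting_state (writer s) (card controls + i)"
    using code_less[of Accept] code_less[of Reject]
    by (simp add: halting_state_def trans_writer)
  moreover have "tape_of (map (\<lambda>x. Cell x False False) (take i s)) (int i) = Sym 0"
    by (simp add: tape_of_def)
  moreover have "tape_of (map (\<lambda>x. Cell x False False) (take (Suc i) s)) =
      (tape_of (map (\<lambda>x. Cell x False False) (take i s)))(int i := Cell (s ! i) False False)"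
    using Suc.prems tape_of_append[of "map (\<lambda>x. Cell x False False) (take i s)"]
    by (simp add: take_Suc_conv_app_nth min_def)
  moreover have "run (writer s) [] (Suc i) = step (writer s) (run (writer s) [] i)"
    by (simp add: run_def)
  ultimately show ?case
    using Suc by (auto simp: step_def trans_writer fun_eq_iff simp del: symbol_code.simps(2))
qed

lemma represents_launch:
  "represents (run (writer s) [] (Suc (length s)))
    (Rewind Ones, int (length s) - 1, tape_of (cells (flagging s 0)))"
proof -
  let ?t = "tape_of (cells (flagging s 0))"
  have cells: "cells (flagging s 0) = map (\<lambda>x. Cell x False False) s"
    by (simp add: cells_def flagging_def)
  have "\<not> halting_state (writer s) (card controls + length s)"
    using code_less[of Accept] code_less[of Reject]
    by (simp add: halting_state_def trans_writer)
  moreover have "?t (int (length s)) = Sym 0"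
    by (simp add: cells tape_of_def)
  moreover have "run (writer s) [] (Suc (length s)) = step (writer s) (run (writer s) [] (length s))"
    by (simp add: run_def)
  \<comment> \<open>The turning state writes a blank onto a blank.\<close>
  moreover have "(symbol_code \<circ> ?t)(int (length s) := 0) = symbol_code \<circ> ?t"
    using \<open>?t (int (length s)) = Sym 0\<close> by (auto simp: fun_eq_iff)
  ultimately have "run (writer s) [] (Suc (length s)) =
      \<lparr>state = code (Rewind Ones), head = int (length s) - 1, tape = symbol_code \<circ> ?t\<rparr>"
    using run_writer[of "length s" s] by (simp add: step_def trans_writer cells)
  moreover have "range ?t \<subseteq> alphabet"
    using blank_in_alphabet by (auto simp: tape_of_def cells alphabet_def)
  ultimately show ?thesis
    by (auto simp: represents_def)
qed

section \<open>The code of the machine as an expansion\<close>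

text \<open>Groups the table into one row per non-halting state, the form in which the blocks become
  visible.\<close>

lemma concat_map_table:
  "concat (map f (table_positions M)) =
     concat (map (\<lambda>q. if halting_state M q then []
       else concat (map (\<lambda>a. f (q, a)) [0..<symbols M])) [0..<states M])"
proof -
  have "concat (map f (concat (map (\<lambda>q. if \<not> halting_state M q then map (Pair q) as else []) qs))) =
      concat (map (\<lambda>q. if halting_state M q then [] else concat (map (\<lambda>a. f (q, a)) as)) qs)" for as qs
    by (induction qs) (simp_all add: comp_def)
  then show ?thesis
    unfolding table_positions_def by simp
qed

lemma digit_letter_of: "set l \<subseteq> {1, 2} \<Longrightarrow> map digit (map letter_of l) = l"
  by (induction l) (auto simp: letter_of_def)

lemma set_zone_text: "set (zone_text z) \<subseteq> {1, 2}"
proof -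
  have unary: "set (unary m) \<subseteq> {1, 2}" for m
    by (auto simp: unary_def)
  have entry: "set (encode_entry e) \<subseteq> {1, 2}" for e
  proof (cases e)
    case (fields q a d)
    then show ?thesis
      using unary by (cases d) (simp_all add: encode_entry_def)
  qed
  have entries: "set default_entries \<subseteq> {1, 2}"
    using entry by (auto simp: default_entries_def)
  have letter: "set (letter_entry x) \<subseteq> {1, 2}" for x
    using unary entries by (auto simp: letter_entry_def)
  have body: "set (encode_entry (body q a)) \<subseteq> {1, 2}" for q a
    by (rule entry)
  show ?thesis
  proof (cases z)
    case ZoneH
    have "set (concat (map (\<lambda>q. if q = code Accept \<or> q = code Reject then []
        else concat (map (\<lambda>a. encode_entry (body q a)) [0..<symbols D + 12])) [0..<card controls]))
      \<subseteq> {1, 2}"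
      using body by (simp add: UN_subset_iff)
    then show ?thesis
      unfolding ZoneH zone_text.simps set_append using unary by (intro Un_least) simp_all
  next
    case ZoneE
    show ?thesis
      unfolding ZoneE zone_text.simps set_append by (intro Un_least entry entries)
  qed (use letter in auto)
qed

lemma digit_zones: "map digit (zones z) = zone_text z"
  unfolding zones_def by (rule digit_letter_of[OF set_zone_text])

lemma zone_text_zone_for: "zone_text (zone_for x) = letter_entry x"
  by (cases x) auto

lemma encode_writer:
  "encode (writer s) = replicate (length s) 1 @ zone_text ZoneP @ zone_text ZoneH @
     concat (map (\<lambda>i. replicate (Suc i) 1 @ zone_text ZoneP @ letter_entry (s ! i)) [0..<length s]) @
     zone_text ZoneE"
proof -
  let ?M = "writer s"
  let ?b = "card controls"
  let ?row = "\<lambda>q. if halting_state ?M q then []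
    else concat (map (\<lambda>a. encode_entry (trans ?M q a)) [0..<symbols D + 12])"
  have upt: "[0..<symbols D + 12] = 0 # [1..<symbols D + 12]"
    using upt_conv_Cons[of 0 "symbols D + 12"] by simp
  have default: "concat (map (\<lambda>a. encode_entry (trans ?M q a)) [1..<symbols D + 12]) = default_entries"
    if "?b \<le> q" for q
  proof -
    have "map (\<lambda>a. encode_entry (trans ?M q a)) [1..<symbols D + 12] =
        map (\<lambda>a. encode_entry (code Accept, 0, Right)) [1..<symbols D + 12]"
      using that by (intro map_cong) (auto simp: trans_writer)
    also have "\<dots> = replicate (symbols D + 11) (encode_entry (code Accept, 0, Right))"
      by (simp only: map_replicate_const length_upt) simp
    finally show ?thesis
      by (simp add: default_entries_def)
  qed
  have running: "\<not> halting_state ?M q" if "?b \<le> q" for q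
    using that code_less[of Accept] code_less[of Reject]
    by (auto simp: halting_state_def trans_writer)
  have row_body: "?row q = (if q = code Accept \<or> q = code Reject then []
       else concat (map (\<lambda>a. encode_entry (body q a)) [0..<symbols D + 12]))" if "q < ?b" for q
    using that by (simp add: halting_state_def trans_writer)
  have row_letter: "?row (?b + i) = replicate (Suc i) 1 @ zone_text ZoneP @ letter_entry (s ! i)"
    if "i < length s" for i
  proof -
    \<comment> \<open>Written as \<open>Suc i + ?b\<close>, the next state has a unary code that
      splits into \<open>1^(i+1)\<close>, \<open>P\<close> and the \<open>2\<close> that opens
      \<open>letter_entry\<close>.\<close>
    have "trans ?M (?b + i) 0 = (Suc i + ?b, symbol_code (Cell (s ! i) False False), Right)"
      using that by (simp add: trans_writer)
    then show ?thesis
      using running[of "?b + i"] default[of "?b + i"]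
      by (simp add: upt encode_entry_def letter_entry_def unary_def replicate_add del: symbol_code.simps)
  qed
  have row_last: "?row (?b + length s) = zone_text ZoneE"
  proof -
    have "trans ?M (?b + length s) 0 = (code (Rewind Ones), 0, Left)"
      by (simp add: trans_writer)
    then show ?thesis
      using running[of "?b + length s"] default[of "?b + length s"] by (simp add: upt)
  qed
  have "[0..<?b + length s + 1] = [0..<?b] @ map (\<lambda>i. ?b + i) [0..<length s] @ [?b + length s]"
    using map_add_upt[of ?b "length s"]
    by (simp add: upt_add_eq_append[of 0 ?b "length s"] add.commute[of _ ?b])
  then have "concat (map (\<lambda>(q, a). encode_entry (trans ?M q a)) (table_positions ?M)) =
      concat (map ?row [0..<?b]) @ concat (map (\<lambda>i. ?row (?b + i)) [0..<length s]) @
      ?row (?b + length s)"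
    by (simp add: concat_map_table comp_def cong: if_cong)
  also have "map ?row [0..<?b] = map (\<lambda>q. if q = code Accept \<or> q = code Reject then []
       else concat (map (\<lambda>a. encode_entry (body q a)) [0..<symbols D + 12])) [0..<?b]"
    using row_body by (intro map_cong) auto
  also have "map (\<lambda>i. ?row (?b + i)) [0..<length s] =
      map (\<lambda>i. replicate (Suc i) 1 @ zone_text ZoneP @ letter_entry (s ! i)) [0..<length s]"
    using row_letter by (intro map_cong) auto
  also note row_last
  finally have table: "concat (map (\<lambda>(q, a). encode_entry (trans ?M q a)) (table_positions ?M)) =
      concat (map (\<lambda>q. if q = code Accept \<or> q = code Reject then []
        else concat (map (\<lambda>a. encode_entry (body q a)) [0..<symbols D + 12])) [0..<?b]) @
      concat (map (\<lambda>i. replicate (Suc i) 1 @ zone_text ZoneP @ letter_entry (s ! i)) [0..<length s]) @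
      zone_text ZoneE" .
  \<comment> \<open>The ones split into \<open>1^n\<close>, \<open>P\<close> and one more, which
    together with the closing \<open>2\<close> opens \<open>H\<close>.\<close>
  have "unary (?b + length s + 1) = replicate (length s) 1 @ replicate ?b 1 @ [1, 2]"
    by (simp add: unary_def replicate_add[symmetric] replicate_append_same add.commute
        flip: append_assoc replicate_Suc)
  then show ?thesis
    unfolding encode_def table by (simp add: trans_writer)
qed

text \<open>The self-reference: \<open>encode_writer\<close> holds for every script, in particular
  for the one that lists the constant words of this very code.\<close>

lemma digit_expansion: "map digit (expansion zones) = encode diagonal_machine"
proof -
  have "map digit (block zones i) =
      replicate (Suc i) 1 @ zone_text ZoneP @ letter_entry (layout zones ! i)" for i
    unfolding block_def by (simp only: map_append digit_zones zone_text_zone_for map_replicate digit.simps)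
  then have "map digit (concat (map (block zones) [0..<length (layout zones)])) =
      concat (map (\<lambda>i. replicate (Suc i) 1 @ zone_text ZoneP @ letter_entry (layout zones ! i))
        [0..<length (layout zones)])"
    by (simp only: map_concat map_map comp_def)
  then show ?thesis
    unfolding diagonal_machine_def encode_writer expansion_def
    by (simp only: map_append digit_zones map_replicate digit.simps)
qed

section \<open>Behaviour of the diagonal machine on its inputs\<close>

lemma reaches_simulation:
  "\<exists>h tp t'. represents (run diagonal_machine [] t')
    (Simulate (state (run D (encode diagonal_machine) t)), h, tp)"
proof -
  let ?s = "layout zones"
  let ?w = "encode diagonal_machine"
  let ?l = "cells (flagging ?s (length ?s)) @ written (expansion zones)"
  have "reaches (Rewind Ones, int (length ?s) - 1, tape_of (cells (flagging ?s 0)))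
      (Scan Ones, 0, tape_of (cells (flagging ?s 0)))"
    using reaches_Rewind[OF blank_notin_cells[of "flagging ?s 0"], where p = Ones and v = "[]"]
    by (simp add: cells_def length_flagging)
  also note reaches_expansion[OF Sep_notin_zones]
  finally have "reaches (Rewind Ones, int (length ?s) - 1, tape_of (cells (flagging ?s 0)))
      (Simulate (start_state D), int (length ?s), tape_of ?l)" .
  moreover have "simulates (int (length ?s)) (initial D ?w)
      (Simulate (start_state D), int (length ?s), tape_of ?l)"
  proof -
    have len: "length (cells (flagging ?s (length ?s))) = length ?s"
      by (simp add: cells_def length_flagging)
    have w: "written (expansion zones) = map Sym ?w"
      by (simp add: written_def flip: digit_expansion)
    have "underlying (tape_of ?l (i + int (length ?s))) = tape (initial D ?w) i" for i
    proof (cases "0 \<le> i")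
      case True
      then have "nat (i + int (length ?s)) = length ?s + nat i"
        by simp
      with True show ?thesis
        by (auto simp: tape_of_def initial_def len w nth_append)
    next
      case False
      \<comment> \<open>To the left of the displaced origin lie the script and then blanks, all read
        as \<open>0\<close>.\<close>
      have "underlying (cells (flagging ?s (length ?s)) ! j) = 0" if "j < length ?s" for j
        using that by (simp add: cells_def length_flagging split: prod.split)
      moreover have "i + int (length ?s) < 0 \<or> nat (i + int (length ?s)) < length ?s"
        using False by linarith
      ultimately show ?thesis
        using False by (auto simp: tape_of_def initial_def len nth_append)
    qed
    then show ?thesis
      by (auto simp: simulates_def initial_def)
  qed
  then obtain y where "reaches (Simulate (start_state D), int (length ?s), tape_of ?l) y"
    and y: "simulates (int (length ?s)) (run D ?w t) y"
    using simulates_run by meson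
  ultimately have "reaches (Rewind Ones, int (length ?s) - 1, tape_of (cells (flagging ?s 0))) y"
    using reaches_trans by meson
  with represents_run[OF represents_launch[of ?s]]
  obtain t' where "represents (run diagonal_machine [] t') y"
    unfolding diagonal_machine_def by blast
  then show ?thesis
    using y unfolding simulates_def by blast
qed

lemma halts_if_rejected:
  assumes "rejects D (encode diagonal_machine)"
  shows "\<exists>t. halting_state diagonal_machine (state (run diagonal_machine [] t))"
proof -
  obtain t where t: "state (run D (encode diagonal_machine) t) = reject_state D"
    using assms by (auto simp: rejects_def)
  obtain h tp t' where rep: "represents (run diagonal_machine [] t') (Simulate (reject_state D), h, tp)"
    using reaches_simulation[of t] unfolding t by blast
  have "accept_state D \<noteq> reject_state D"
    using machine by (simp add: turing_machine_def)
  then have "reaches (Simulate (reject_state D), h, tp) (Accept, h + 1, tp)"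
    by (intro reaches_move) simp
  from represents_run[OF rep[unfolded diagonal_machine_def] this]
  obtain t'' where "represents (run diagonal_machine [] t'') (Accept, h + 1, tp)"
    unfolding diagonal_machine_def by blast
  then have "state (run diagonal_machine [] t'') = code Accept"
    by (auto simp: represents_def)
  then show ?thesis
    by (auto simp: halting_state_def diagonal_machine_def)
qed

text \<open>Once \<open>Simulate (accept_state D)\<close> is reached it persists, and so does a
  halting state. Both would hold at time \<open>t + t'\<close>.\<close>

lemma loops_if_accepted:
  assumes "accepts D (encode diagonal_machine)"
  shows "\<not> halting_state diagonal_machine (state (run diagonal_machine [] t))"
proof
  assume halted: "halting_state diagonal_machine (state (run diagonal_machine [] t))"
  obtain u where u: "state (run D (encode diagonal_machine) u) = accept_state D"
    using assms by (auto simp: accepts_def)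
  obtain h tp t' where rep: "represents (run diagonal_machine [] t') (Simulate (accept_state D), h, tp)"
    using reaches_simulation[of u] unfolding u by blast
  have loop: "\<exists>h. represents (run diagonal_machine [] (m + t')) (Simulate (accept_state D), h, tp)" for m
  proof (induction m)
    case 0
    then show ?case using rep by auto
  next
    case (Suc m)
    then obtain h where
      "represents (run diagonal_machine [] (m + t')) (Simulate (accept_state D), h, tp)"
      by blast
    from represents_step[OF this] show ?case
      by (auto simp: run_def diagonal_machine_def)
  qed
  have "run diagonal_machine [] (m + t) = run diagonal_machine [] t" for m
  proof (induction m)
    case (Suc m)
    have "run diagonal_machine [] (Suc m + t) =
        step diagonal_machine (run diagonal_machine [] (m + t))"
      by (simp add: run_def)
    then show ?case
      using Suc halted by (simp add: step_def)
  qed simp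
  then have "halting_state diagonal_machine (state (run diagonal_machine [] (t + t')))"
    using halted by (metis add.commute)
  moreover obtain h' where
    "represents (run diagonal_machine [] (t + t')) (Simulate (accept_state D), h', tp)"
    using loop by blast
  ultimately show False
    using halting_writer[of "Simulate (accept_state D)" "layout zones"]
    by (auto simp: represents_def diagonal_machine_def)
qed

text \<open>The start state reads the input letter \<open>1\<close>, which is not blank, and enters
  \<open>code Accept\<close>.\<close>

lemma halts_on_nonempty:
  assumes "input_word diagonal_machine w" and "w \<noteq> []"
  shows "halting_state diagonal_machine (state (run diagonal_machine w 1))"
proof -
  have "w ! 0 = 1"
    using assms nth_mem[of 0 w] unfolding input_word_def diagonal_machine_def by fastforce
  then show ?thesis
    using assms(2) code_less[of Accept] code_less[of Reject]
    by (simp add: run_def step_def initial_def trans_writer diagonal_machine_def halting_state_def)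
qed

end

section \<open>Undecidability from the diagonal machine\<close>

lemma halts_after_le:
  assumes "halting_state M (state (run M w t))"
  shows "\<exists>s\<le>t. halts_after M w s"
  using ex_least_nat_le[of "\<lambda>s. halting_state M (state (run M w s))", OF assms]
  by (auto simp: halts_after_def)

theorem theorem4p2:
  fixes F :: "(nat \<Rightarrow> real) set"
  assumes nonneg: "\<And>T n. T \<in> F \<Longrightarrow> 0 \<le> T n"
    and large: "arbitrarily_large_constants F"
  shows "\<not> algorithmically_decidable (\<lambda>M. \<exists>T \<in> F. runs_in_time M T)"
proof
  let ?P = "\<lambda>M. \<exists>T \<in> F. runs_in_time M T"
  assume "algorithmically_decidable ?P"
  then obtain D where "turing_machine D" "2 \<le> inputs D" and D: "decides D ?P"
    by (auto simp: algorithmically_decidable_def)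
  then interpret diagonal D
    by unfold_locales
  let ?M = diagonal_machine
  have M: "turing_machine ?M"
    unfolding diagonal_machine_def by (rule turing_machine_writer)
  show False
  proof (cases "?P ?M")
    case True
    \<comment> \<open>Any time bound forces a halt on the empty input, whereas the acceptance by
      \<open>D\<close> makes the machine loop there.\<close>
    moreover have "input_word ?M []"
      by (simp add: input_word_def)
    ultimately obtain t where "halts_after ?M [] t"
      unfolding runs_in_time_def by blast
    moreover have "accepts D (encode ?M)"
      using D M True by (simp add: decides_def)
    ultimately show False
      using loops_if_accepted by (auto simp: halts_after_def)
  next
    case False
    then have "rejects D (encode ?M)"
      using D M by (simp add: decides_def)
    then obtain t where t: "halting_state ?M (state (run ?M [] t))"
      using halts_if_rejected by blast
    \<comment> \<open>A single constant serves all inputs: \<open>t\<close> steps suffice on the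
      empty word, one step on every other.\<close>
    obtain c where c: "real (max 1 t) \<le> c" "(\<lambda>n. c) \<in> F"
      using large by (auto simp: arbitrarily_large_constants_def)
    have "\<exists>s. halts_after ?M w s \<and> real s \<le> c" if w: "input_word ?M w" for w
    proof -
      obtain s where "s \<le> max 1 t" "halts_after ?M w s"
      proof (cases "w = []")
        case True
        then show ?thesis
          using halts_after_le[OF t] that by (meson le_max_iff_disj)
      next
        case False
        then show ?thesis
          using halts_after_le[OF halts_on_nonempty[OF w]] that by (meson le_max_iff_disj)
      qed
      then show ?thesis
        using c(1) by (intro exI[of _ s]) linarith
    qed
    then have "runs_in_time ?M (\<lambda>n. c)"
      by (auto simp: runs_in_time_def)
    with c(2) False show False
      by blast
  qed
qed

end
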